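(* Let $g^{lk}+\varepsilon h^{lk}$ be an infinitesimal deformation of a Kähler-Poisson tensor $g^{lk}$ on a complex manifold $M$, and let $S,T$ be the source and target mappings of the deformation formal symplectic groupoid with separation of variables over $(M,g^{lk}+\varepsilon h^{lk})$, given locally by \[ Sf=e^{\mathfrak D+\varepsilon\mathfrak E}f,\qquad Tf=e^{\bar{\mathfrak D}+\varepsilon\bar{\mathfrak E}}f . \] Write $S=S_0+\varepsilon S_1$, $T=T_0+\varepsilon T_1$ (so that $S_0f=e^{\mathfrak D}f$ and $T_0f=e^{\bar{\mathfrak D}}f$). Then \[ S_1f=\left(\frac{e^{\mathrm{ad}(\mathfrak D)}-1}{\mathrm{ad}(\mathfrak D)}(\mathfrak E)\right)S_0f \quad\text{and}\quad T_1f=\left(\frac{e^{\mathrm{ad}(\bar{\mathfrak D})}-1}{\mathrm{ad}(\bar{\mathfrak D})}(\bar{\mathfrak E})\right)T_0f . \]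
   Context: $\varepsilon$ is a formal parameter with $\varepsilon^2=0$; summation over repeated indices is assumed; $f$ is a smooth (complex-valued) function on a coordinate chart $U\subset M$ with holomorphic coordinates $z^k$ and conjugates $\bar z^l$; $\zeta_k,\bar\zeta_l$ are the dual fibre coordinates on $T^*U$. A Kähler-Poisson tensor is a Poisson tensor of type $(1,1)$ on a complex manifold, written $g^{lk}$ ($k$ holomorphic index, $l$ antiholomorphic index), possibly degenerate; the Jacobi identity is $g^{lk}\partial_{z^k}g^{qp}=g^{qk}\partial_{z^k}g^{lp}$ and $g^{lk}\partial_{\bar z^l}g^{qp}=g^{lp}\partial_{\bar z^l}g^{qk}$. An infinitesimal deformation $g^{lk}+\varepsilon h^{lk}$ is given by a tensor $h^{lk}$ of type $(1,1)$ with \[ g^{lk}\frac{\partial h^{qp}}{\partial z^k}+h^{lk}\frac{\partial g^{qp}}{\partial z^k}=g^{qk}\frac{\partial h^{lp}}{\partial z^k}+h^{qk}\frac{\partial g^{lp}}{\partial z^k},\qquad g^{lk}\frac{\partial h^{qp}}{\partial\bar z^l}+h^{lk}\frac{\partial g^{qp}}{\partial\bar z^l}=g^{lp}\frac{\partial h^{qk}}{\partial\bar z^l}+h^{lp}\frac{\partial g^{qk}}{\partial\bar z^l}. \] The operators are \[ \mathfrak D=\zeta_kg^{lk}\frac{\partial}{\partial\bar z^l},\quad \bar{\mathfrak D}=\bar\zeta_lg^{lk}\frac{\partial}{\partial z^k},\quad \mathfrak E=\zeta_kh^{lk}\frac{\partial}{\partial\bar z^l},\quad \bar{\mathfrak E}=\bar\zeta_lh^{lk}\frac{\partial}{\partial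 z^k}, \] acting on formal power series in $\zeta_k,\bar\zeta_l$ with coefficients in $C^\infty(U)$ (the $\zeta_k,\bar\zeta_l$ act by multiplication). $\mathrm{ad}(A)(B)=[A,B]$, and $\frac{e^{x}-1}{x}=\sum_{n\ge0}\frac{x^n}{(n+1)!}$. All exponentials and the right-hand sides of the asserted formulas are understood as formal series in the fibre variables. *)

theory Defs
  imports "HOL-Analysis.Analysis" "HOL-Library.Groups_Big_Fun"
begin

section \<open>Calculus on open subsets of complex \<open>n\<close>-space\<close>

text \<open>Smoothness is in the real sense: all iterated real directional derivatives exist and are
  continuous. It is meant for open \<open>V\<close>.\<close>

primrec Ck_on :: "nat \<Rightarrow> (complex^'n \<Rightarrow> complex) \<Rightarrow> (complex^'n) set \<Rightarrow> bool" where
  "Ck_on 0 f V \<longleftrightarrow> continuous_on V f"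
| "Ck_on (Suc k) f V \<longleftrightarrow>
     (\<forall>x\<in>V. f differentiable (at x)) \<and> (\<forall>v. Ck_on k (\<lambda>x. frechet_derivative f (at x) v) V)"

definition smooth_on :: "(complex^'n \<Rightarrow> complex) \<Rightarrow> (complex^'n) set \<Rightarrow> bool" where
  "smooth_on f V \<longleftrightarrow> (\<forall>k. Ck_on k f V)"

text \<open>The Wirtinger derivatives with respect to \<open>z\<^sup>k\<close> and to the conjugate of \<open>z\<^sup>l\<close>: the real and
  the imaginary directions of the \<open>k\<close>-th coordinate are \<open>axis k 1\<close> and \<open>axis k \<i>\<close>.\<close>

definition dz :: "'n::finite \<Rightarrow> (complex^'n \<Rightarrow> complex) \<Rightarrow> complex^'n \<Rightarrow> complex" where
  "dz k f x =
     (frechet_derivative f (at x) (axis k 1) - \<i> * frechet_derivative f (at x) (axis k \<i>)) / 2"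

definition dzbar :: "'n::finite \<Rightarrow> (complex^'n \<Rightarrow> complex) \<Rightarrow> complex^'n \<Rightarrow> complex" where
  "dzbar l f x =
     (frechet_derivative f (at x) (axis l 1) + \<i> * frechet_derivative f (at x) (axis l \<i>)) / 2"

definition holomorphic_map_on :: "(complex^'n \<Rightarrow> complex^'m) \<Rightarrow> (complex^'n) set \<Rightarrow> bool" where
  "holomorphic_map_on f V \<longleftrightarrow>
     (\<forall>x\<in>V. \<exists>f'. (f has_derivative f') (at x) \<and> (\<forall>c v. f' (c *s v) = c *s f' v))"

section \<open>Complex manifolds and tensors of type (1,1)\<close>

text \<open>A chart is a pair of its domain and its coordinate map. The manifold is the whole type \<open>'m\<close>
  (used below with Hausdorff and second countable \<open>'m\<close>); \<open>'n\<close> indexes the coordinates.\<close>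

type_synonym ('m, 'n) chart = "'m set \<times> ('m \<Rightarrow> complex^'n)"

definition chart_range :: "('m, 'n) chart \<Rightarrow> (complex^'n) set" where
  "chart_range c = snd c ` fst c"

definition chart_inv :: "('m, 'n) chart \<Rightarrow> complex^'n \<Rightarrow> 'm" where
  "chart_inv c = inv_into (fst c) (snd c)"

definition complex_atlas :: "('m::topological_space, 'n::finite) chart set \<Rightarrow> bool" where
  "complex_atlas \<A> \<longleftrightarrow>
     (\<Union>c\<in>\<A>. fst c) = UNIV \<and>
     (\<forall>c\<in>\<A>. open (fst c) \<and> open (chart_range c) \<and>
        homeomorphism (fst c) (chart_range c) (snd c) (chart_inv c)) \<and>
     (\<forall>c\<in>\<A>. \<forall>c'\<in>\<A>.
        holomorphic_map_on (snd c' \<circ> chart_inv c) (snd c ` (fst c \<inter> fst c')))"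

text \<open>A (contravariant) tensor of type (1,1) is given by its components in all charts:
  \<open>g c l k\<close> is \<open>g\<^sup>l\<^sup>k\<close> in the chart \<open>c\<close>, as a function of the coordinates, where the first index is
  antiholomorphic and the second one holomorphic.\<close>

type_synonym 'n components = "'n \<Rightarrow> 'n \<Rightarrow> complex^'n \<Rightarrow> complex"

type_synonym ('m, 'n) tensor = "('m, 'n) chart \<Rightarrow> 'n components"

definition tensor_11 :: "('m, 'n::finite) chart set \<Rightarrow> ('m, 'n) tensor \<Rightarrow> bool" where
  "tensor_11 \<A> g \<longleftrightarrow>
     (\<forall>c\<in>\<A>. \<forall>l k. smooth_on (g c l k) (chart_range c)) \<and>
     (\<forall>c\<in>\<A>. \<forall>c'\<in>\<A>. \<forall>l k. \<forall>p \<in> fst c \<inter> fst c'.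
        let \<tau> = (\<lambda>i z. snd c' (chart_inv c z) $ i); x = snd c p in
        g c' l k (snd c' p) = (\<Sum>a\<in>UNIV. \<Sum>b\<in>UNIV. cnj (dz a (\<tau> l) x) * dz b (\<tau> k) x * g c a b x))"

definition kaehler_poisson :: "('m, 'n::finite) chart set \<Rightarrow> ('m, 'n) tensor \<Rightarrow> bool" where
  "kaehler_poisson \<A> g \<longleftrightarrow>
     tensor_11 \<A> g \<and>
     (\<forall>c\<in>\<A>. \<forall>x\<in>chart_range c.
        (\<forall>l q p. (\<Sum>k\<in>UNIV. g c l k x * dz k (g c q p) x) = (\<Sum>k\<in>UNIV. g c q k x * dz k (g c l p) x)) \<and>
        (\<forall>k q p. (\<Sum>l\<in>UNIV. g c l k x * dzbar l (g c q p) x) = (\<Sum>l\<in>UNIV. g c l p x * dzbar l (g c q k) x)))"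

definition infinitesimal_deformation ::
  "('m, 'n::finite) chart set \<Rightarrow> ('m, 'n) tensor \<Rightarrow> ('m, 'n) tensor \<Rightarrow> bool" where
  "infinitesimal_deformation \<A> g h \<longleftrightarrow>
     tensor_11 \<A> h \<and>
     (\<forall>c\<in>\<A>. \<forall>x\<in>chart_range c.
        (\<forall>l q p. (\<Sum>k\<in>UNIV. g c l k x * dz k (h c q p) x + h c l k x * dz k (g c q p) x) =
                 (\<Sum>k\<in>UNIV. g c q k x * dz k (h c l p) x + h c q k x * dz k (g c l p) x)) \<and>
        (\<forall>k q p. (\<Sum>l\<in>UNIV. g c l k x * dzbar l (h c q p) x + h c l k x * dzbar l (g c q p) x) =
                 (\<Sum>l\<in>UNIV. g c l p x * dzbar l (h c q k) x + h c l p x * dzbar l (g c q k) x)))"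

section \<open>Formal series in the fibre variables\<close>

text \<open>A formal power series in the fibre coordinates of the cotangent bundle is the family of its
  coefficients, which are functions of the base coordinates. In a multi-index \<open>\<alpha>\<close>,
  \<open>\<alpha> (Inl k)\<close> is the exponent of \<open>\<zeta>\<^sub>k\<close> and \<open>\<alpha> (Inr l)\<close> the exponent of the conjugate of \<open>\<zeta>\<^sub>l\<close>.
  Coefficients matter only on the range of the chart, hence \<open>series_eq_on\<close>.\<close>

type_synonym 'n series = "('n + 'n \<Rightarrow> nat) \<Rightarrow> complex^'n \<Rightarrow> complex"

definition series_eq_on :: "(complex^'n) set \<Rightarrow> 'n series \<Rightarrow> 'n series \<Rightarrow> bool" where
  "series_eq_on V F G \<longleftrightarrow> (\<forall>\<alpha>. \<forall>x\<in>V. F \<alpha> x = G \<alpha> x)"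

definition const_series :: "(complex^'n \<Rightarrow> complex) \<Rightarrow> 'n series" where
  "const_series f = (\<lambda>\<alpha> x. if \<alpha> = (\<lambda>_. 0) then f x else 0)"

definition fibre_mult :: "'n + 'n \<Rightarrow> 'n series \<Rightarrow> 'n series" where
  "fibre_mult i F = (\<lambda>\<alpha> x. if \<alpha> i = 0 then 0 else F (\<alpha>(i := \<alpha> i - 1)) x)"

definition D_op :: "'n::finite components \<Rightarrow> 'n series \<Rightarrow> 'n series" where
  "D_op g F = (\<lambda>\<alpha> x. \<Sum>k\<in>UNIV. \<Sum>l\<in>UNIV.
     fibre_mult (Inl k) (\<lambda>\<beta> y. g l k y * dzbar l (F \<beta>) y) \<alpha> x)"

definition Dbar_op :: "'n::finite components \<Rightarrow> 'n series \<Rightarrow> 'n series" where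
  "Dbar_op g F = (\<lambda>\<alpha> x. \<Sum>k\<in>UNIV. \<Sum>l\<in>UNIV.
     fibre_mult (Inr l) (\<lambda>\<beta> y. g l k y * dz k (F \<beta>) y) \<alpha> x)"

text \<open>Infinite sums of series are taken coefficientwise as finite sums. \<open>Sum_any\<close> is \<open>0\<close> on a family
  of infinite support; that this does not occur in the sums below is the content of the
  \<open>finite_support\<close> lemmas at the end.\<close>

definition formal_sum :: "(nat \<Rightarrow> 'n series) \<Rightarrow> 'n series" where
  "formal_sum X = (\<lambda>\<alpha> x. Sum_any (\<lambda>n. X n \<alpha> x))"

definition exp_op :: "('n series \<Rightarrow> 'n series) \<Rightarrow> 'n series \<Rightarrow> 'n series" where
  "exp_op A F = formal_sum (\<lambda>n \<alpha> x. (A ^^ n) F \<alpha> x / fact n)"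

definition ad :: "('n series \<Rightarrow> 'n series) \<Rightarrow> ('n series \<Rightarrow> 'n series) \<Rightarrow> 'n series \<Rightarrow> 'n series" where
  "ad A B = (\<lambda>F \<alpha> x. A (B F) \<alpha> x - B (A F) \<alpha> x)"

text \<open>The operator \<open>((e\<^sup>x - 1) / x) (B)\<close> at \<open>x = ad A\<close>.\<close>

definition exp_quot_ad :: "('n series \<Rightarrow> 'n series) \<Rightarrow> ('n series \<Rightarrow> 'n series) \<Rightarrow> 'n series \<Rightarrow> 'n series" where
  "exp_quot_ad A B F = formal_sum (\<lambda>n \<alpha> x. (ad A ^^ n) B F \<alpha> x / fact (n + 1))"

section \<open>The formal parameter \<open>\<epsilon>\<close> with \<open>\<epsilon>\<^sup>2 = 0\<close>\<close>

text \<open>\<open>Dual F\<^sub>0 F\<^sub>1\<close> stands for \<open>F\<^sub>0 + \<epsilon> F\<^sub>1\<close>, and \<open>dual_op A B\<close> is the \<open>\<epsilon>\<close>-linear operator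
  \<open>A + \<epsilon> B\<close>.\<close>

datatype 'n dual_series = Dual (part0: "'n series") (part1: "'n series")

definition dual_op ::
  "('n series \<Rightarrow> 'n series) \<Rightarrow> ('n series \<Rightarrow> 'n series) \<Rightarrow> 'n dual_series \<Rightarrow> 'n dual_series" where
  "dual_op A B F = Dual (A (part0 F)) (\<lambda>\<alpha> x. A (part1 F) \<alpha> x + B (part0 F) \<alpha> x)"

definition dual_exp :: "('n dual_series \<Rightarrow> 'n dual_series) \<Rightarrow> 'n dual_series \<Rightarrow> 'n dual_series" where
  "dual_exp P F = Dual
     (formal_sum (\<lambda>n \<alpha> x. part0 ((P ^^ n) F) \<alpha> x / fact n))
     (formal_sum (\<lambda>n \<alpha> x. part1 ((P ^^ n) F) \<alpha> x / fact n))"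

text \<open>The local expressions of the source and target mappings over \<open>g + \<epsilon> h\<close>.\<close>

definition source_map ::
  "'n::finite components \<Rightarrow> 'n components \<Rightarrow> (complex^'n \<Rightarrow> complex) \<Rightarrow> 'n dual_series" where
  "source_map g h f =
     dual_exp (dual_op (D_op g) (D_op h)) (Dual (const_series f) (\<lambda>\<alpha> x. 0))"

definition target_map ::
  "'n::finite components \<Rightarrow> 'n components \<Rightarrow> (complex^'n \<Rightarrow> complex) \<Rightarrow> 'n dual_series" where
  "target_map g h f =
     dual_exp (dual_op (Dbar_op g) (Dbar_op h)) (Dual (const_series f) (\<lambda>\<alpha> x. 0))"

section \<open>The formal sums are coefficientwise finite\<close>

definition vanishes_below :: "nat \<Rightarrow> 'n::finite series \<Rightarrow> bool" where
  "vanishes_below j F \<longleftrightarrow> (\<forall>\<alpha>. sum \<alpha> UNIV < j \<longrightarrow> F \<alpha> = (\<lambda>_. 0))"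

definition raises :: "nat \<Rightarrow> ('n::finite series \<Rightarrow> 'n series) \<Rightarrow> bool" where
  "raises m A \<longleftrightarrow> (\<forall>F j. vanishes_below j F \<longrightarrow> vanishes_below (j + m) (A F))"

lemma dz_zero [simp]: "dz k (\<lambda>_. 0) x = 0" and dzbar_zero [simp]: "dzbar k (\<lambda>_. 0) x = 0"
  by (simp_all add: dz_def dzbar_def)

lemma fibre_mult_vanishes:
  fixes F :: "'n::finite series"
  assumes "vanishes_below j F" "sum \<alpha> UNIV < Suc j"
  shows "fibre_mult i F \<alpha> x = 0"
proof (cases "\<alpha> i = 0")
  case False
  have "sum \<alpha> UNIV = \<alpha> i + sum \<alpha> (UNIV - {i})"
    by (simp add: sum.remove)
  moreover have "sum (\<alpha>(i := \<alpha> i - 1)) UNIV = (\<alpha> i - 1) + sum \<alpha> (UNIV - {i})"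
    by (subst sum.remove[of _ i]) (auto intro!: sum.cong)
  ultimately have "sum (\<alpha>(i := \<alpha> i - 1)) UNIV < j"
    using False assms(2) by linarith
  with assms(1) show ?thesis
    unfolding vanishes_below_def fibre_mult_def by metis
qed (simp add: fibre_mult_def)

lemma raises_D_op: "raises 1 (D_op g)" and raises_Dbar_op: "raises 1 (Dbar_op g)"
proof -
  have *: "vanishes_below j (\<lambda>\<beta> y. g l k y * dzbar l (F \<beta>) y)"
          "vanishes_below j (\<lambda>\<beta> y. g l k y * dz k (F \<beta>) y)"
    if "vanishes_below j F" for j l k and F :: "'a series"
    using that by (simp_all add: vanishes_below_def)
  show "raises 1 (D_op g)" "raises 1 (Dbar_op g)"
    unfolding raises_def D_op_def Dbar_op_def
    using fibre_mult_vanishes[OF *(1)] fibre_mult_vanishes[OF *(2)]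
    by (auto simp: vanishes_below_def[of "Suc _"] fun_eq_iff)
qed

lemma raises_funpow: "raises 1 A \<Longrightarrow> vanishes_below j F \<Longrightarrow> vanishes_below (j + n) ((A ^^ n) F)"
  by (induction n) (auto simp: raises_def)

lemma raises_ad_funpow:
  assumes "raises 1 A" "raises 1 B"
  shows "raises (Suc n) ((ad A ^^ n) B)"
proof (induction n)
  case (Suc n)
  let ?C = "(ad A ^^ n) B"
  have "vanishes_below (j + Suc (Suc n)) (A (?C F))" "vanishes_below (j + Suc (Suc n)) (?C (A F))"
    if F: "vanishes_below j F" for j and F :: "'a series"
  proof -
    have "vanishes_below (j + Suc n + 1) (A (?C F))" "vanishes_below (j + 1 + Suc n) (?C (A F))"
      using assms(1) Suc F unfolding raises_def by blast+
    then show "vanishes_below (j + Suc (Suc n)) (A (?C F))" "vanishes_below (j + Suc (Suc n)) (?C (A F))"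
      by simp_all
  qed
  moreover have "(ad A ^^ Suc n) B F = (\<lambda>\<alpha> x. A (?C F) \<alpha> x - ?C (A F) \<alpha> x)" for F
    by (simp add: ad_def[of A ?C])
  ultimately show ?case
    by (simp add: raises_def vanishes_below_def)
qed (use assms(2) in simp)

lemma finite_support_vanishing:
  fixes c :: "nat \<Rightarrow> complex"
  assumes "\<And>n. vanishes_below n (X n)"
  shows "finite {n. X n \<alpha> x / c n \<noteq> 0}"
proof (rule finite_subset)
  show "{n. X n \<alpha> x / c n \<noteq> 0} \<subseteq> {..sum \<alpha> UNIV}"
  proof
    fix n assume "n \<in> {n. X n \<alpha> x / c n \<noteq> 0}"
    then have "X n \<alpha> \<noteq> (\<lambda>_. 0)"
      by auto
    then show "n \<in> {..sum \<alpha> UNIV}"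
      using assms[of n] unfolding vanishes_below_def atMost_iff by (meson not_le)
  qed
qed simp

lemma finite_support_exp_op:
  assumes "raises 1 A"
  shows "finite {n. (A ^^ n) F \<alpha> x / fact n \<noteq> 0}"
  using raises_funpow[OF assms, of 0 F]
  by (intro finite_support_vanishing) (simp add: vanishes_below_def)

lemma finite_support_exp_quot_ad:
  assumes "raises 1 A" "raises 1 B"
  shows "finite {n. (ad A ^^ n) B F \<alpha> x / fact (n + 1) \<noteq> 0}"
proof (rule finite_support_vanishing)
  fix n
  have "vanishes_below (0 + Suc n) ((ad A ^^ n) B F)"
    using raises_ad_funpow[OF assms, of n] unfolding raises_def
    by (metis vanishes_below_def not_less_zero)
  then show "vanishes_below n ((ad A ^^ n) B F)"
    by (simp add: vanishes_below_def)
qed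

lemma finite_support_dual_exp:
  assumes "raises 1 A" "raises 1 B"
  shows "finite {n. part0 ((dual_op A B ^^ n) F) \<alpha> x / fact n \<noteq> 0}"
    and "finite {n. part1 ((dual_op A B ^^ n) F) \<alpha> x / fact n \<noteq> 0}"
proof -
  have "vanishes_below n (part0 ((dual_op A B ^^ n) F)) \<and>
        vanishes_below n (part1 ((dual_op A B ^^ n) F))" for n
  proof (induction n)
    case (Suc n)
    let ?G = "(dual_op A B ^^ n) F"
    have "vanishes_below (n + 1) (A (part0 ?G))" "vanishes_below (n + 1) (A (part1 ?G))"
         "vanishes_below (n + 1) (B (part0 ?G))"
      using Suc assms by (simp_all only: raises_def)
    moreover have "part0 (dual_op A B ?G) = A (part0 ?G)"
         "part1 (dual_op A B ?G) = (\<lambda>\<alpha> x. A (part1 ?G) \<alpha> x + B (part0 ?G) \<alpha> x)"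
      by (simp_all add: dual_op_def)
    ultimately show ?case
      by (simp add: vanishes_below_def)
  qed (simp add: vanishes_below_def)
  then show "finite {n. part0 ((dual_op A B ^^ n) F) \<alpha> x / fact n \<noteq> 0}"
    and "finite {n. part1 ((dual_op A B ^^ n) F) \<alpha> x / fact n \<noteq> 0}"
    by (intro finite_support_vanishing; blast)+
qed

end

theory Submission
  imports Defs
begin

text \<open>The statement is Duhamel's formula for the derivative of the exponential map. It holds for any
  two operators \<open>A\<close> and \<open>B\<close> that act linearly on formal series with smooth coefficients and raise the
  degree in the fibre variables; the operators of the theorem are of this kind. Since
  \<open>\<epsilon>\<^sup>2 = 0\<close>, the \<open>\<epsilon>\<close>-part \<open>v\<^sub>n\<close> of \<open>(A + \<epsilon> B)\<^sup>n F\<close> satisfies \<open>v\<^sub>n\<^sub>+\<^sub>1 = A v\<^sub>n + B A\<^sup>n F\<close>. Moving all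
  powers of \<open>A\<close> to the right by means of \<open>A C = ad A C + C A\<close> and using Pascal's rule, one finds
  that \<open>v\<^sub>n\<close> is the sum over \<open>m < n\<close> of \<open>(n choose (m + 1)) (ad A)\<^sup>m (B) A\<^sup>j F\<close> with \<open>j = n - 1 - m\<close>
  (\<open>part1_dual_funpow\<close>). Division by \<open>n!\<close> turns the binomial coefficient into
  \<open>1 / ((m + 1)! j!)\<close>, so that the sum over \<open>n\<close> becomes the double sum over
  \<open>m\<close> and \<open>j\<close> of \<open>(ad A)\<^sup>m (B) / (m + 1)!\<close> applied to \<open>A\<^sup>j F / j!\<close>, which is the asserted product
  (\<open>duhamel_dual_exp\<close>).

  The rest is bookkeeping of two kinds. Differential operators are additive only on differentiable
  functions, and only on the open set where these are differentiable; hence linearity is formulated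
  for smooth series, with values compared on an open set, and one needs that the operators
  preserve smoothness. Infinite sums are finite in every degree because the operators raise the
  degree; for the same reason an operator may be applied to an infinite sum term by term
  (\<open>operator_formal_sum\<close>).\<close>

section \<open>Smooth functions\<close>

lemma frechet_derivative_cong_open:
  assumes "open V" "x \<in> V" "\<And>y. y \<in> V \<Longrightarrow> f y = g y"
  shows "frechet_derivative f (at x) = frechet_derivative g (at x)"
proof -
  have "(f has_derivative D) (at x) \<longleftrightarrow> (g has_derivative D) (at x)" for D
    using has_derivative_transform_within_open[OF _ assms(1,2)] assms(3) by metis
  then show ?thesis
    by (simp add: frechet_derivative_def)
qed

lemma Ck_on_cong:
  assumes "open V" "\<And>y. y \<in> V \<Longrightarrow> f y = g y" "Ck_on k f V"
  shows "Ck_on k g V"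
  using assms(2,3)
proof (induction k arbitrary: f g)
  case 0
  then show ?case
    by (simp add: continuous_on_eq)
next
  case (Suc k)
  have "g differentiable (at x)" if "x \<in> V" for x
    using Suc.prems that has_derivative_transform_within_open[OF _ assms(1) that]
    unfolding differentiable_def Ck_on.simps by metis
  moreover have "Ck_on k (\<lambda>x. frechet_derivative g (at x) v) V" for v
  proof (rule Suc.IH)
    show "frechet_derivative f (at y) v = frechet_derivative g (at y) v" if "y \<in> V" for y
      using frechet_derivative_cong_open[OF assms(1) that, of f g] Suc.prems(1) by simp
  qed (use Suc.prems(2) in simp)
  ultimately show ?case
    by simp
qed

text \<open>Needed for products: the derivative of \<open>f g\<close> contains the undifferentiated factors, to which
  the induction hypothesis applies only at the lower order.\<close>

lemma Ck_on_SucD: "Ck_on (Suc k) f V \<Longrightarrow> Ck_on k f V"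
proof (induction k arbitrary: f)
  case 0
  then show ?case
    by (auto intro!: continuous_at_imp_continuous_on differentiable_imp_continuous_within)
next
  case (Suc k)
  from Suc.prems show ?case
    unfolding Ck_on.simps(2)[of "Suc k"] Ck_on.simps(2)[of k f] using Suc.IH by blast
qed

lemma frechet_derivative_add:
  assumes "f differentiable (at x)" "g differentiable (at x)"
  shows "frechet_derivative (\<lambda>x. f x + g x) (at x) v =
    frechet_derivative f (at x) v + frechet_derivative g (at x) v"
  using fun_cong[OF frechet_derivative_at[OF has_derivative_add[OF assms[unfolded frechet_derivative_works]]], of v]
  by simp

lemma Ck_on_add:
  assumes "open V"
  shows "Ck_on k f V \<Longrightarrow> Ck_on k g V \<Longrightarrow> Ck_on k (\<lambda>x. f x + g x) V"
proof (induction k arbitrary: f g)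
  case (Suc k)
  have "Ck_on k (\<lambda>x. frechet_derivative f (at x) v + frechet_derivative g (at x) v) V" for v
    using Suc by simp
  then have "Ck_on k (\<lambda>x. frechet_derivative (\<lambda>x. f x + g x) (at x) v) V" for v
    using Suc.prems by (rule_tac Ck_on_cong[OF assms]) (auto simp: frechet_derivative_add)
  then show ?case
    using Suc.prems by simp
qed (simp add: continuous_on_add)

lemma frechet_derivative_mult:
  fixes f g :: "'a::real_normed_vector \<Rightarrow> complex"
  assumes "f differentiable (at x)" "g differentiable (at x)"
  shows "frechet_derivative (\<lambda>x. f x * g x) (at x) v =
    f x * frechet_derivative g (at x) v + frechet_derivative f (at x) v * g x"
  using fun_cong[OF frechet_derivative_at[OF has_derivative_mult[OF assms[unfolded frechet_derivative_works]]], of v]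
  by simp

lemma Ck_on_mult:
  assumes "open V"
  shows "Ck_on k f V \<Longrightarrow> Ck_on k g V \<Longrightarrow> Ck_on k (\<lambda>x. f x * g x) V"
proof (induction k arbitrary: f g)
  case (Suc k)
  have "Ck_on k (\<lambda>x. f x * frechet_derivative g (at x) v + frechet_derivative f (at x) v * g x) V" for v
    using Suc.prems Ck_on_SucD[OF Suc.prems(1)] Ck_on_SucD[OF Suc.prems(2)]
    by (intro Ck_on_add[OF assms] Suc.IH) simp_all
  then have "Ck_on k (\<lambda>x. frechet_derivative (\<lambda>x. f x * g x) (at x) v) V" for v
    using Suc.prems by (rule_tac Ck_on_cong[OF assms]) (auto simp: frechet_derivative_mult)
  then show ?case
    using Suc.prems by simp
qed (simp add: continuous_on_mult)

lemma Ck_on_const: "Ck_on k (\<lambda>x. c) V"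
  by (induction k arbitrary: c) simp_all

lemma smooth_on_const: "smooth_on (\<lambda>x. c) V"
  by (simp add: smooth_on_def Ck_on_const)

lemma smooth_on_add: "open V \<Longrightarrow> smooth_on f V \<Longrightarrow> smooth_on g V \<Longrightarrow> smooth_on (\<lambda>x. f x + g x) V"
  by (simp add: smooth_on_def Ck_on_add)

lemma smooth_on_mult: "open V \<Longrightarrow> smooth_on f V \<Longrightarrow> smooth_on g V \<Longrightarrow> smooth_on (\<lambda>x. f x * g x) V"
  by (simp add: smooth_on_def Ck_on_mult)

lemma smooth_on_sum:
  assumes "open V" "\<And>i. i \<in> I \<Longrightarrow> smooth_on (f i) V"
  shows "smooth_on (\<lambda>x. \<Sum>i\<in>I. f i x) V"
  using assms(2)
  by (induction I rule: infinite_finite_induct) (auto intro: smooth_on_const smooth_on_add[OF assms(1)])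

lemma smooth_on_frechet_derivative:
  assumes "smooth_on f V"
  shows "smooth_on (\<lambda>x. frechet_derivative f (at x) v) V"
  using assms Ck_on.simps(2) unfolding smooth_on_def by blast

lemma smooth_on_differentiable: "smooth_on f V \<Longrightarrow> x \<in> V \<Longrightarrow> f differentiable (at x)"
  using Ck_on.simps(2) unfolding smooth_on_def by blast

section \<open>Linear operators on smooth functions and on smooth series\<close>

text \<open>The last clause does not follow from linearity: it says that on \<open>V\<close> the operator does not see
  the values of a function outside \<open>V\<close>. The same holds for \<open>linear_on_smooth\<close> below.\<close>

definition linear_on_smooth_functions ::
  "(complex^'n) set \<Rightarrow> ((complex^'n \<Rightarrow> complex) \<Rightarrow> complex^'n \<Rightarrow> complex) \<Rightarrow> bool" where
  "linear_on_smooth_functions V d \<longleftrightarrow>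
     (\<forall>f. smooth_on f V \<longrightarrow> smooth_on (d f) V) \<and>
     (\<forall>f g c. smooth_on f V \<longrightarrow> smooth_on g V \<longrightarrow>
        (\<forall>x\<in>V. d (\<lambda>y. f y + c * g y) x = d f x + c * d g x)) \<and>
     (\<forall>f g. (\<forall>y\<in>V. f y = g y) \<longrightarrow> (\<forall>x\<in>V. d f x = d g x))"

lemma frechet_derivative_add_scaled:
  assumes "smooth_on f V" "smooth_on g V" "x \<in> V"
  shows "frechet_derivative (\<lambda>y. f y + c * g y) (at x) v =
    frechet_derivative f (at x) v + c * frechet_derivative g (at x) v"
proof -
  have "f differentiable (at x)" "g differentiable (at x)"
    using assms smooth_on_differentiable by blast+
  then show ?thesis
    by (simp add: frechet_derivative_add frechet_derivative_mult)
qed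

lemma linear_combination_of_directional_derivatives:
  fixes V :: "(complex^'n::finite) set"
  assumes "open V"
  shows "linear_on_smooth_functions V
    (\<lambda>f x. a * frechet_derivative f (at x) v + b * frechet_derivative f (at x) w)"
  unfolding linear_on_smooth_functions_def
proof (intro conjI allI impI ballI)
  fix f g :: "complex^'n \<Rightarrow> complex" and x
  assume "\<forall>y\<in>V. f y = g y" "x \<in> V"
  then have "frechet_derivative f (at x) = frechet_derivative g (at x)"
    by (intro frechet_derivative_cong_open[OF assms]) auto
  then show "a * frechet_derivative f (at x) v + b * frechet_derivative f (at x) w =
      a * frechet_derivative g (at x) v + b * frechet_derivative g (at x) w"
    by simp
qed (auto simp: frechet_derivative_add_scaled algebra_simps
    intro!: smooth_on_add[OF assms] smooth_on_mult[OF assms] smooth_on_const smooth_on_frechet_derivative)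

lemma linear_dz: "open V \<Longrightarrow> linear_on_smooth_functions V (dz k)"
  using linear_combination_of_directional_derivatives[of V "1/2" "axis k 1" "-\<i>/2" "axis k \<i>"]
  by (simp add: dz_def[abs_def] diff_divide_distrib)

lemma linear_dzbar: "open V \<Longrightarrow> linear_on_smooth_functions V (dzbar k)"
  using linear_combination_of_directional_derivatives[of V "1/2" "axis k 1" "\<i>/2" "axis k \<i>"]
  by (simp add: dzbar_def[abs_def] add_divide_distrib)

definition smooth_series :: "(complex^'n) set \<Rightarrow> 'n series \<Rightarrow> bool" where
  "smooth_series V F \<longleftrightarrow> (\<forall>\<alpha>. smooth_on (F \<alpha>) V)"

definition linear_on_smooth :: "(complex^'n) set \<Rightarrow> ('n series \<Rightarrow> 'n series) \<Rightarrow> bool" where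
  "linear_on_smooth V A \<longleftrightarrow>
     (\<forall>F. smooth_series V F \<longrightarrow> smooth_series V (A F)) \<and>
     (\<forall>F G c. smooth_series V F \<longrightarrow> smooth_series V G \<longrightarrow>
        series_eq_on V (A (\<lambda>\<alpha> x. F \<alpha> x + c * G \<alpha> x)) (\<lambda>\<alpha> x. A F \<alpha> x + c * A G \<alpha> x)) \<and>
     (\<forall>F G. series_eq_on V F G \<longrightarrow> series_eq_on V (A F) (A G))"

lemma linear_on_smoothD:
  assumes "linear_on_smooth V A"
  shows "smooth_series V F \<Longrightarrow> smooth_series V (A F)"
    and "smooth_series V F \<Longrightarrow> smooth_series V G \<Longrightarrow> x \<in> V \<Longrightarrow>
      A (\<lambda>\<alpha> x. F \<alpha> x + c * G \<alpha> x) \<alpha> x = A F \<alpha> x + c * A G \<alpha> x"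
    and "series_eq_on V F G \<Longrightarrow> x \<in> V \<Longrightarrow> A F \<alpha> x = A G \<alpha> x"
  using assms unfolding linear_on_smooth_def series_eq_on_def by blast+

lemma smooth_const_series: "smooth_on f V \<Longrightarrow> smooth_series V (const_series f)"
  unfolding smooth_series_def
proof
  fix \<alpha> assume "smooth_on f V"
  then show "smooth_on (const_series f \<alpha>) V"
    by (cases "\<alpha> = (\<lambda>_. 0)") (simp_all add: const_series_def smooth_on_const)
qed

lemma smooth_series_zero: "smooth_series V (\<lambda>\<alpha> x. 0)"
  by (simp add: smooth_series_def smooth_on_const)

lemma smooth_series_add_scaled:
  "open V \<Longrightarrow> smooth_series V F \<Longrightarrow> smooth_series V G \<Longrightarrow>
     smooth_series V (\<lambda>\<alpha> x. F \<alpha> x + c * G \<alpha> x)"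
  by (simp add: smooth_series_def smooth_on_add smooth_on_mult smooth_on_const)

lemma smooth_series_sum:
  "open V \<Longrightarrow> (\<And>i. i \<in> I \<Longrightarrow> smooth_series V (F i)) \<Longrightarrow>
     smooth_series V (\<lambda>\<alpha> x. \<Sum>i\<in>I. c i * F i \<alpha> x)"
  by (simp add: smooth_series_def smooth_on_sum smooth_on_mult smooth_on_const)

lemma linear_on_smooth_sum_ops:
  fixes A :: "'i \<Rightarrow> 'n::finite series \<Rightarrow> 'n series"
  assumes "open V" "\<And>i. i \<in> I \<Longrightarrow> linear_on_smooth V (A i)"
  shows "linear_on_smooth V (\<lambda>F \<alpha> x. \<Sum>i\<in>I. A i F \<alpha> x)"
proof -
  have "smooth_series V (\<lambda>\<alpha> x. \<Sum>i\<in>I. A i F \<alpha> x)" if "smooth_series V F" for F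
    using smooth_series_sum[OF assms(1), of I "\<lambda>i. A i F" "\<lambda>_. 1"] that
    by (simp add: linear_on_smoothD(1)[OF assms(2)])
  moreover have "(\<Sum>i\<in>I. A i (\<lambda>\<alpha> x. F \<alpha> x + c * G \<alpha> x) \<alpha> x) =
      (\<Sum>i\<in>I. A i F \<alpha> x) + c * (\<Sum>i\<in>I. A i G \<alpha> x)"
    if "smooth_series V F" "smooth_series V G" "x \<in> V" for F G c x \<alpha>
    using that by (simp add: linear_on_smoothD(2)[OF assms(2)] sum.distrib sum_distrib_left)
  moreover have "(\<Sum>i\<in>I. A i F \<alpha> x) = (\<Sum>i\<in>I. A i G \<alpha> x)"
    if "series_eq_on V F G" "x \<in> V" for F G x \<alpha>
    using that linear_on_smoothD(3)[OF assms(2)] by (intro sum.cong) auto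
  ultimately show ?thesis
    unfolding linear_on_smooth_def series_eq_on_def by blast
qed

lemma smooth_series_fibre_mult: "smooth_series V F \<Longrightarrow> smooth_series V (fibre_mult i F)"
  unfolding smooth_series_def
proof
  fix \<alpha> assume "\<forall>\<alpha>. smooth_on (F \<alpha>) V"
  then show "smooth_on (fibre_mult i F \<alpha>) V"
    by (cases "\<alpha> i = 0") (simp_all add: fibre_mult_def smooth_on_const)
qed

lemma linear_on_smooth_first_order:
  assumes "open V" "smooth_on a V" "linear_on_smooth_functions V d"
  shows "linear_on_smooth V (\<lambda>F. fibre_mult i (\<lambda>\<beta> y. a y * d (F \<beta>) y))"
proof -
  have "smooth_series V (fibre_mult i (\<lambda>\<beta> y. a y * d (F \<beta>) y))" if "smooth_series V F" for F
    using assms(3) that unfolding linear_on_smooth_functions_def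
    by (intro smooth_series_fibre_mult) (simp add: smooth_series_def smooth_on_mult[OF assms(1,2)])
  then show ?thesis
    using assms(3)
    unfolding linear_on_smooth_def linear_on_smooth_functions_def series_eq_on_def
    by (auto simp: fibre_mult_def smooth_series_def algebra_simps)
qed

lemma linear_D_op:
  assumes "open V" "\<And>l k. smooth_on (g l k) V"
  shows "linear_on_smooth V (D_op g)"
  unfolding D_op_def[abs_def]
  by (intro linear_on_smooth_sum_ops linear_on_smooth_first_order linear_dzbar assms)

lemma linear_Dbar_op:
  assumes "open V" "\<And>l k. smooth_on (g l k) V"
  shows "linear_on_smooth V (Dbar_op g)"
  unfolding Dbar_op_def[abs_def]
  by (intro linear_on_smooth_sum_ops linear_on_smooth_first_order linear_dz assms)

lemma linear_on_smooth_ad: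
  assumes "open V" "linear_on_smooth V A" "linear_on_smooth V B"
  shows "linear_on_smooth V (ad A B)"
proof -
  note A = linear_on_smoothD[OF assms(2)] and B = linear_on_smoothD[OF assms(3)]
  have "smooth_series V (ad A B F)" if "smooth_series V F" for F
    using smooth_series_add_scaled[OF assms(1), of "A (B F)" "B (A F)" "-1"] that A(1) B(1)
    by (simp add: ad_def)
  moreover have "ad A B (\<lambda>\<alpha> x. F \<alpha> x + c * G \<alpha> x) \<alpha> x = ad A B F \<alpha> x + c * ad A B G \<alpha> x"
    if F: "smooth_series V F" and G: "smooth_series V G" and x: "x \<in> V" for F G c x \<alpha>
  proof -
    let ?H = "\<lambda>\<alpha> x. F \<alpha> x + c * G \<alpha> x"
    have "A (B ?H) \<alpha> x = A (\<lambda>\<alpha> x. B F \<alpha> x + c * B G \<alpha> x) \<alpha> x"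
      using B(2)[OF F G] x by (intro A(3)) (auto simp: series_eq_on_def)
    moreover have "B (A ?H) \<alpha> x = B (\<lambda>\<alpha> x. A F \<alpha> x + c * A G \<alpha> x) \<alpha> x"
      using A(2)[OF F G] x by (intro B(3)) (auto simp: series_eq_on_def)
    ultimately show ?thesis
      using F G x by (simp add: ad_def A(1,2) B(1,2) algebra_simps)
  qed
  moreover have "ad A B F \<alpha> x = ad A B G \<alpha> x" if "series_eq_on V F G" "x \<in> V" for F G x \<alpha>
  proof -
    have "series_eq_on V (A F) (A G)" "series_eq_on V (B F) (B G)"
      using that A(3) B(3) by (auto simp: series_eq_on_def)
    then show ?thesis
      using that(2) A(3) B(3) unfolding ad_def by metis
  qed
  ultimately show ?thesis
    unfolding linear_on_smooth_def series_eq_on_def by blast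
qed

lemma linear_on_smooth_ad_funpow:
  assumes "open V" "linear_on_smooth V A" "linear_on_smooth V B"
  shows "linear_on_smooth V ((ad A ^^ n) B)"
  by (induction n) (simp_all add: assms linear_on_smooth_ad)

lemma smooth_series_funpow:
  assumes "linear_on_smooth V A" "smooth_series V F"
  shows "smooth_series V ((A ^^ n) F)"
  by (induction n) (simp_all add: assms linear_on_smoothD(1))

text \<open>The terms have the form \<open>c i * F i\<close> in order to cover sums with scalar coefficients, which
  occur as binomial coefficients and as inverse factorials.\<close>

lemma linear_on_smooth_sum:
  assumes "open V" "linear_on_smooth V A" "finite I" "\<And>i. i \<in> I \<Longrightarrow> smooth_series V (F i)" "x \<in> V"
  shows "A (\<lambda>\<alpha> x. \<Sum>i\<in>I. c i * F i \<alpha> x) \<alpha> x = (\<Sum>i\<in>I. c i * A (F i) \<alpha> x)"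
  using assms(3,4)
proof (induction I)
  case empty
  \<comment> \<open>Linearity at \<open>F = G = 0\<close> and \<open>c = 1\<close> reads \<open>A 0 = A 0 + A 0\<close>.\<close>
  then show ?case
    using linear_on_smoothD(2)[OF assms(2) smooth_series_zero smooth_series_zero assms(5), of 1 \<alpha>]
    by simp
next
  case (insert i I)
  have "A (\<lambda>\<alpha> x. (\<Sum>i\<in>I. c i * F i \<alpha> x) + c i * F i \<alpha> x) \<alpha> x
      = A (\<lambda>\<alpha> x. \<Sum>i\<in>I. c i * F i \<alpha> x) \<alpha> x + c i * A (F i) \<alpha> x"
    using insert.prems assms by (intro linear_on_smoothD(2) smooth_series_sum) auto
  then show ?case
    using insert by (simp add: add.commute)
qed

section \<open>Formal sums\<close>

lemma formal_sum_eq_sum: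
  assumes "\<And>n. vanishes_below n (X n)" "sum \<alpha> UNIV \<le> N"
  shows "formal_sum X \<alpha> x = (\<Sum>n\<le>N. X n \<alpha> x)"
  unfolding formal_sum_def
proof (rule Sum_any.expand_superset)
  show "{n. X n \<alpha> x \<noteq> 0} \<subseteq> {..N}"
  proof
    fix n assume n: "n \<in> {n. X n \<alpha> x \<noteq> 0}"
    have "X n \<alpha> = (\<lambda>_. 0)" if "N < n"
      using assms(1)[of n] assms(2) that unfolding vanishes_below_def by (blast intro: le_less_trans)
    then show "n \<in> {..N}"
      using n by (force simp: not_less)
  qed
qed simp

lemma vanishes_below_0: "vanishes_below 0 F"
  by (simp add: vanishes_below_def)

lemma raises_vanishes_below: 
  assumes "raises m A" "vanishes_below j F"
  shows "vanishes_below j (A F)"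
proof -
  have "vanishes_below (j + m) (A F)"
    using assms unfolding raises_def by blast
  then show ?thesis
    by (simp add: vanishes_below_def)
qed

lemma smooth_formal_sum:
  assumes "open V" "\<And>n. smooth_series V (X n)" "\<And>n. vanishes_below n (X n)"
  shows "smooth_series V (formal_sum X)"
  unfolding smooth_series_def
proof
  fix \<alpha>
  have "smooth_on (\<lambda>x. \<Sum>n\<le>sum \<alpha> UNIV. X n \<alpha> x) V"
    using assms(2) by (intro smooth_on_sum[OF assms(1)]) (simp add: smooth_series_def)
  then show "smooth_on (formal_sum X \<alpha>) V"
    unfolding formal_sum_eq_sum[OF assms(3) order_refl, abs_def] .
qed

text \<open>In degree \<open>N\<close> the terms beyond \<open>N\<close> are invisible, and an operator that does not lower the degree
  cannot bring them back; so finite linearity suffices.\<close>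

lemma operator_formal_sum:
  assumes "open V" "linear_on_smooth V A" "raises m A"
    and X: "\<And>n. smooth_series V (X n)" "\<And>n. vanishes_below n (X n)" and "x \<in> V"
  shows "A (formal_sum X) \<alpha> x = formal_sum (\<lambda>n. A (X n)) \<alpha> x"
proof -
  define N where "N = sum \<alpha> UNIV"
  \<comment> \<open>The partial sum and the remainder; the factors \<open>1\<close> and \<open>-1\<close> give them the form to which the
    linearity lemmas apply.\<close>
  define P where "P = (\<lambda>\<alpha> x. \<Sum>n\<le>N. 1 * X n \<alpha> x)"
  define R where "R = (\<lambda>\<alpha> x. formal_sum X \<alpha> x + (-1) * P \<alpha> x)"
  have P: "smooth_series V P"
    unfolding P_def by (intro smooth_series_sum assms)
  have R: "smooth_series V R"
    unfolding R_def by (intro smooth_series_add_scaled smooth_formal_sum P assms)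
  have "vanishes_below (Suc N) R"
    using formal_sum_eq_sum[OF X(2)]
    by (auto simp: vanishes_below_def R_def P_def fun_eq_iff less_Suc_eq_le)
  then have AR: "A R \<alpha> x = 0"
    using raises_vanishes_below[OF assms(3)] by (auto simp: vanishes_below_def N_def)
  have "A (formal_sum X) \<alpha> x = A (\<lambda>\<alpha> x. P \<alpha> x + 1 * R \<alpha> x) \<alpha> x"
    by (simp add: R_def)
  also have "\<dots> = A P \<alpha> x"
    using linear_on_smoothD(2)[OF assms(2) P R assms(6), of 1 \<alpha>] AR by simp
  also have "\<dots> = (\<Sum>n\<le>N. A (X n) \<alpha> x)"
    unfolding P_def using linear_on_smooth_sum[OF assms(1,2), of "{..N}" X x "\<lambda>_. 1" \<alpha>] assms by simp
  also have "\<dots> = formal_sum (\<lambda>n. A (X n)) \<alpha> x"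
    using X(2) raises_vanishes_below[OF assms(3)]
    by (intro formal_sum_eq_sum[symmetric]) (auto simp: N_def)
  finally show ?thesis .
qed

section \<open>Duhamel's formula\<close>

lemma part0_dual_funpow: "part0 ((dual_op A B ^^ n) F) = (A ^^ n) (part0 F)"
  by (induction n) (simp_all add: dual_op_def)

lemma part0_dual_exp: "part0 (dual_exp (dual_op A B) F) = exp_op A (part0 F)"
  by (simp add: dual_exp_def exp_op_def part0_dual_funpow)

text \<open>The normally ordered form of the \<open>\<epsilon>\<close>-part of \<open>(A + \<epsilon> B)\<^sup>n F\<close>, with all powers of \<open>A\<close> to the right
  of the iterated commutators.\<close>

lemma part1_dual_funpow:
  fixes F :: "'n::finite series"
  assumes "open V" "linear_on_smooth V A" "linear_on_smooth V B" "smooth_series V F"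
  shows "series_eq_on V (part1 ((dual_op A B ^^ n) (Dual F (\<lambda>\<alpha> x. 0))))
    (\<lambda>\<alpha> x. \<Sum>m<n. of_nat (n choose Suc m) * (ad A ^^ m) B ((A ^^ (n - Suc m)) F) \<alpha> x)"
proof (induction n)
  case 0
  then show ?case
    by (simp add: series_eq_on_def)
next
  case (Suc n)
  define v where "v n = part1 ((dual_op A B ^^ n) (Dual F (\<lambda>\<alpha> x. 0)))" for n
  have smooth: "smooth_series V ((ad A ^^ m) B ((A ^^ k) F))" for m k
    using linear_on_smoothD(1)[OF linear_on_smooth_ad_funpow] smooth_series_funpow assms by blast
  have "v (Suc n) \<alpha> x =
      (\<Sum>m<Suc n. of_nat (Suc n choose Suc m) * (ad A ^^ m) B ((A ^^ (Suc n - Suc m)) F) \<alpha> x)"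
    if x: "x \<in> V" for \<alpha> x
  proof -
    define c where "c m k = (ad A ^^ m) B ((A ^^ k) F) \<alpha> x" for m k
    \<comment> \<open>Moving one \<open>A\<close> past \<open>(ad A)\<^sup>m (B)\<close> costs a commutator.\<close>
    have "A ((ad A ^^ m) B ((A ^^ k) F)) \<alpha> x = c (Suc m) k + c m (Suc k)" for m k
      by (simp add: c_def ad_def[of A "(ad A ^^ m) B"])
    then have "A (v n) \<alpha> x =
        (\<Sum>m<n. of_nat (n choose Suc m) * (c (Suc m) (n - Suc m) + c m (Suc (n - Suc m))))"
      using linear_on_smoothD(3)[OF assms(2) Suc x, of \<alpha>]
        linear_on_smooth_sum[OF assms(1,2) _ _ x,
          of "{..<n}" "\<lambda>m. (ad A ^^ m) B ((A ^^ (n - Suc m)) F)" "\<lambda>m. of_nat (n choose Suc m)" \<alpha>] smooth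
      by (simp add: v_def)
    also have "\<dots> = (\<Sum>m<n. of_nat (n choose Suc m) * c (Suc m) (n - Suc m)) +
        (\<Sum>m<n. of_nat (n choose Suc m) * c m (n - m))"
      by (simp add: distrib_left sum.distrib Suc_diff_Suc)
    finally have Av: "A (v n) \<alpha> x =
        (\<Sum>m<n. of_nat (n choose Suc m) * c (Suc m) (n - Suc m)) +
        (\<Sum>m<n. of_nat (n choose Suc m) * c m (n - m))" .
    \<comment> \<open>Both sums are extended to \<open>m \<le> n\<close>, the first one by the new term \<open>B A\<^sup>n F\<close> and the second one
      by zero, so that Pascal's rule applies termwise.\<close>
    have "(\<Sum>m<Suc n. of_nat (n choose m) * c m (n - m)) =
        c 0 n + (\<Sum>m<n. of_nat (n choose Suc m) * c (Suc m) (n - Suc m))"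
      by (subst sum.lessThan_Suc_shift) simp
    moreover have "(\<Sum>m<Suc n. of_nat (n choose Suc m) * c m (n - m)) =
        (\<Sum>m<n. of_nat (n choose Suc m) * c m (n - m))"
      by simp
    ultimately have "A (v n) \<alpha> x + c 0 n =
        (\<Sum>m<Suc n. of_nat (n choose m) * c m (n - m)) +
        (\<Sum>m<Suc n. of_nat (n choose Suc m) * c m (n - m))"
      by (simp only: Av ac_simps)
    also have "\<dots> = (\<Sum>m<Suc n. of_nat (Suc n choose Suc m) * c m (n - m))"
      by (simp only: binomial_Suc_Suc of_nat_add distrib_right sum.distrib)
    finally show ?thesis
      by (simp add: v_def c_def dual_op_def[of A B "(dual_op A B ^^ n) _"] part0_dual_funpow del: sum.lessThan_Suc)
  qed
  then show ?case
    by (simp only: v_def series_eq_on_def) blast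
qed

lemma dual_funpow_vanishes:
  assumes "raises 1 A" "raises 1 B"
  shows "vanishes_below n (part1 ((dual_op A B ^^ n) F))"
proof (induction n)
  case (Suc n)
  have "vanishes_below n ((A ^^ n) (part0 F))"
    using raises_funpow[OF assms(1), of 0 "part0 F" n] by (simp add: vanishes_below_def)
  then have "vanishes_below (n + 1) (B (part0 ((dual_op A B ^^ n) F)))"
    "vanishes_below (n + 1) (A (part1 ((dual_op A B ^^ n) F)))"
    using Suc assms by (simp_all only: raises_def part0_dual_funpow)
  then show ?case
    by (simp add: vanishes_below_def dual_op_def[of A B "(dual_op A B ^^ n) F"])
qed (simp add: vanishes_below_def)

text \<open>Duhamel's formula: with \<open>C = ((exp (ad A) - 1) / ad A) (B)\<close>, the \<open>\<epsilon>\<close>-part of \<open>exp (A + \<epsilon> B)\<close> is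
  \<open>C \<circ> exp A\<close>. The coefficients at a fixed \<open>\<alpha>\<close> of degree \<open>N\<close> are compared; on both sides they are
  finite sums of the terms \<open>t m j\<close>.\<close>

lemma duhamel_dual_exp:
  fixes F :: "'n::finite series"
  assumes V: "open V" and A: "linear_on_smooth V A" "raises 1 A"
    and B: "linear_on_smooth V B" "raises 1 B" and F: "smooth_series V F"
  shows "series_eq_on V (part1 (dual_exp (dual_op A B) (Dual F (\<lambda>\<alpha> x. 0))))
    (exp_quot_ad A B (exp_op A F))"
  unfolding series_eq_on_def
proof (intro allI ballI)
  fix \<alpha> :: "'n + 'n \<Rightarrow> nat" and x assume x: "x \<in> V"
  define N where "N = sum \<alpha> UNIV"
  define v where "v n = part1 ((dual_op A B ^^ n) (Dual F (\<lambda>\<alpha> x. 0)))" for n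
  define C where "C m = (ad A ^^ m) B" for m
  define t where "t m j = C m ((A ^^ j) F) \<alpha> x / (fact (Suc m) * fact j)" for m j

  have C: "linear_on_smooth V (C m)" "raises (Suc m) (C m)" for m
    unfolding C_def by (intro linear_on_smooth_ad_funpow raises_ad_funpow V A B)+
  have AF: "vanishes_below j ((A ^^ j) F)" for j
    using raises_funpow[OF A(2), of 0 F j] by (simp add: vanishes_below_def)
  \<comment> \<open>\<open>(ad A)\<^sup>m (B) A\<^sup>j\<close> raises the degree by \<open>m + 1 + j\<close>, so it contributes to degree \<open>N\<close> only if
    \<open>m + j < N\<close>. Hence the triangle of the left-hand side may be replaced by a square.\<close>
  have t_0: "t m j = 0" if "N \<le> m + j" for m j
  proof -
    have "vanishes_below (j + Suc m) (C m ((A ^^ j) F))"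
      using C(2)[of m] AF[of j] unfolding raises_def by blast
    then show ?thesis
      using that by (simp add: t_def vanishes_below_def N_def)
  qed

  have coeff: "(\<Sum>m<Suc n. of_nat (Suc n choose Suc m) * C m ((A ^^ (Suc n - Suc m)) F) \<alpha> x) / fact (Suc n)
      = (\<Sum>m\<le>n. t m (n - m))" for n
    unfolding sum_divide_distrib lessThan_Suc_atMost
  proof (rule sum.cong)
    fix m assume "m \<in> {..n}"
    then have "(of_nat (Suc n choose Suc m) :: complex) = fact (Suc n) / (fact (Suc m) * fact (n - m))"
      using binomial_fact[of "Suc m" "Suc n"] by simp
    then show "of_nat (Suc n choose Suc m) * C m ((A ^^ (Suc n - Suc m)) F) \<alpha> x / fact (Suc n) = t m (n - m)"
      by (simp add: t_def del: fact_Suc)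
  qed simp
  have v_Suc: "v (Suc n) \<alpha> x / fact (Suc n) = (\<Sum>m\<le>n. t m (n - m))" for n
  proof -
    have "v (Suc n) \<alpha> x =
        (\<Sum>m<Suc n. of_nat (Suc n choose Suc m) * C m ((A ^^ (Suc n - Suc m)) F) \<alpha> x)"
      using part1_dual_funpow[OF V A(1) B(1) F, of "Suc n"] x
      unfolding series_eq_on_def v_def C_def by blast
    then show ?thesis
      by (simp only: coeff)
  qed

  have "part1 (dual_exp (dual_op A B) (Dual F (\<lambda>\<alpha> x. 0))) \<alpha> x = (\<Sum>n\<le>N. v n \<alpha> x / fact n)"
    unfolding dual_exp_def dual_series.sel v_def
    using dual_funpow_vanishes[OF A(2) B(2)]
    by (intro formal_sum_eq_sum) (auto simp: vanishes_below_def N_def)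
  also have "\<dots> = (\<Sum>n<N. v (Suc n) \<alpha> x / fact (Suc n))"
    unfolding lessThan_Suc_atMost[symmetric] sum.lessThan_Suc_shift by (simp add: v_def)
  also have "\<dots> = (\<Sum>(m, j)\<in>{(m, j). m + j < N}. t m j)"
    unfolding v_Suc by (rule sum.triangle_reindex[symmetric])
  also have "\<dots> = (\<Sum>(m, j)\<in>{..N} \<times> {..N}. t m j)"
    using t_0 by (intro sum.mono_neutral_left) (auto simp flip: not_le)
  also have "\<dots> = (\<Sum>m\<le>N. \<Sum>j\<le>N. t m j)"
    by (simp add: sum.cartesian_product)
  also have "\<dots> = (\<Sum>m\<le>N. C m (exp_op A F) \<alpha> x / fact (m + 1))"
  proof (rule sum.cong)
    fix m
    let ?X = "\<lambda>j \<alpha> x. (A ^^ j) F \<alpha> x / fact j"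
    have scale: "C m (?X j) \<alpha> x = C m ((A ^^ j) F) \<alpha> x / fact j" for j
      using linear_on_smooth_sum[OF V C(1)[of m] _ _ x, of "{0::nat}" "\<lambda>_. (A ^^ j) F" "\<lambda>_. 1 / fact j" \<alpha>]
        smooth_series_funpow[OF A(1) F] by simp
    have X: "smooth_series V (?X j)" "vanishes_below j (?X j)" for j
      using smooth_series_sum[OF V, of "{0::nat}" "\<lambda>_. (A ^^ j) F" "\<lambda>_. 1 / fact j"]
        smooth_series_funpow[OF A(1) F] AF[of j] by (simp_all add: vanishes_below_def)
    have "C m (exp_op A F) \<alpha> x = formal_sum (\<lambda>j. C m (?X j)) \<alpha> x"
      unfolding exp_op_def by (intro operator_formal_sum[OF V C X x])
    also have "\<dots> = (\<Sum>j\<le>N. C m (?X j) \<alpha> x)"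
      using raises_vanishes_below[OF C(2) X(2)] by (intro formal_sum_eq_sum) (simp_all add: N_def)
    finally show "(\<Sum>j\<le>N. t m j) = C m (exp_op A F) \<alpha> x / fact (m + 1)"
      unfolding scale by (simp add: t_def sum_divide_distrib mult.commute del: fact_Suc)
  qed simp
  also have "\<dots> = exp_quot_ad A B (exp_op A F) \<alpha> x"
  proof -
    have "vanishes_below (0 + Suc m) (C m (exp_op A F))" for m
      using C(2)[of m] unfolding raises_def by (blast intro: vanishes_below_0)
    then show ?thesis
      unfolding exp_quot_ad_def C_def
      by (intro formal_sum_eq_sum[symmetric]) (auto simp: vanishes_below_def N_def)
  qed
  finally show "part1 (dual_exp (dual_op A B) (Dual F (\<lambda>\<alpha> x. 0))) \<alpha> x = exp_quot_ad A B (exp_op A F) \<alpha> x" .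
qed

theorem lemma2:
  fixes \<A> :: "('m::{t2_space,second_countable_topology}, 'n::finite) chart set"
    and g h :: "('m, 'n) tensor"
    and U :: "'m set" and \<phi> :: "'m \<Rightarrow> complex^'n" and f :: "'m \<Rightarrow> complex"
  assumes "complex_atlas \<A>"
    and "kaehler_poisson \<A> g"
    and "infinitesimal_deformation \<A> g h"
    and "(U, \<phi>) \<in> \<A>"
    and "smooth_on (f \<circ> chart_inv (U, \<phi>)) (\<phi> ` U)"
  shows "let c = (U, \<phi>);
             f\<^sub>c = f \<circ> chart_inv c;
             D = D_op (g c); Dbar = Dbar_op (g c);
             E = D_op (h c); Ebar = Dbar_op (h c);
             S0f = part0 (source_map (g c) (h c) f\<^sub>c); S1f = part1 (source_map (g c) (h c) f\<^sub>c);
             T0f = part0 (target_map (g c) (h c) f\<^sub>c); T1f = part1 (target_map (g c) (h c) f\<^sub>c)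
         in series_eq_on (\<phi> ` U) S0f (exp_op D (const_series f\<^sub>c)) \<and>
            series_eq_on (\<phi> ` U) T0f (exp_op Dbar (const_series f\<^sub>c)) \<and>
            series_eq_on (\<phi> ` U) S1f (exp_quot_ad D E S0f) \<and>
            series_eq_on (\<phi> ` U) T1f (exp_quot_ad Dbar Ebar T0f)"
proof -
  define c where "c = (U, \<phi>)"
  define f\<^sub>c where "f\<^sub>c = f \<circ> chart_inv c"
  have c: "c \<in> \<A>" and range: "chart_range c = \<phi> ` U"
    using assms(4) by (simp_all add: c_def chart_range_def)
  then have V: "open (\<phi> ` U)"
    using assms(1) unfolding complex_atlas_def by metis
  have g: "smooth_on (g c l k) (\<phi> ` U)" and h: "smooth_on (h c l k) (\<phi> ` U)" for l k
    using assms(2,3) c unfolding kaehler_poisson_def infinitesimal_deformation_def tensor_11_def range[symmetric]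
    by blast+
  have F: "smooth_series (\<phi> ` U) (const_series f\<^sub>c)"
    using assms(5) by (intro smooth_const_series) (simp add: f\<^sub>c_def c_def)
  show ?thesis
    using duhamel_dual_exp[OF V linear_D_op[OF V g] raises_D_op linear_D_op[OF V h] raises_D_op F]
      duhamel_dual_exp[OF V linear_Dbar_op[OF V g] raises_Dbar_op linear_Dbar_op[OF V h] raises_Dbar_op F]
    unfolding Let_def source_map_def target_map_def part0_dual_exp
    by (simp add: c_def f\<^sub>c_def series_eq_on_def)
qed

end
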